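(* Let $\mathcal{E}$ be an additive regular category. Any full (additive) subcategory $\mathcal{E}' \subseteq \mathcal{E}$ which is closed under subobjects (i.e. for every monomorphism $X \hookrightarrow Y$ in $\mathcal{E}$ with $Y \in \mathcal{E}'$ one has $X \in \mathcal{E}'$) is also an additive regular category.
   Context: All categories are essentially small and additive (in particular subcategories are additive), and all functors are additive. An additive category is called \emph{additive regular} if (Reg1) every morphism $f$ has a factorization $f = m\circ p$ where $p$ is a cokernel (i.e. a cokernel of some morphism) and $m$ is a monomorphism, and (Reg2) the pullback of every cokernel along any morphism exists and the pullback of a cokernel is a cokernel. *)

theory Defs
  imports "HOL-Algebra.Group"
begin

text \<open>
  Composition is written in the usual order: \<open>g \<cdot>\<^bsub>C\<^esub> f\<close> is "first f, then g".
  Objects and arrows are carved out of types as sets, so every category below is small.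
  The operations are unconstrained outside the carriers \<open>Obj\<close> and \<open>Arr\<close>.
\<close>

record ('o, 'm) cat_data =
  Obj :: "'o set"
  Arr :: "'m set"
  Dom :: "'m \<Rightarrow> 'o"
  Cod :: "'m \<Rightarrow> 'o"
  Id :: "'o \<Rightarrow> 'm"
  Comp :: "'m \<Rightarrow> 'm \<Rightarrow> 'm" (infixl "\<cdot>\<index>" 70)
  Add :: "'m \<Rightarrow> 'm \<Rightarrow> 'm"
  Zero :: "'o \<Rightarrow> 'o \<Rightarrow> 'm"

definition Hom :: "('o, 'm) cat_data \<Rightarrow> 'o \<Rightarrow> 'o \<Rightarrow> 'm set" where
  "Hom C A B = {f \<in> Arr C. Dom C f = A \<and> Cod C f = B}"

locale category =
  fixes C :: "('o, 'm) cat_data" (structure)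
  assumes Dom_in_Obj: "f \<in> Arr C \<Longrightarrow> Dom C f \<in> Obj C"
    and Cod_in_Obj: "f \<in> Arr C \<Longrightarrow> Cod C f \<in> Obj C"
    and Id_in_Hom: "A \<in> Obj C \<Longrightarrow> Id C A \<in> Hom C A A"
    and Comp_in_Hom: "\<lbrakk>f \<in> Hom C X Y; g \<in> Hom C Y Z\<rbrakk> \<Longrightarrow> g \<cdot> f \<in> Hom C X Z"
    and Comp_Id: "f \<in> Hom C X Y \<Longrightarrow> f \<cdot> Id C X = f"
    and Id_Comp: "f \<in> Hom C X Y \<Longrightarrow> Id C Y \<cdot> f = f"
    and Comp_assoc: "\<lbrakk>f \<in> Hom C W X; g \<in> Hom C X Y; h \<in> Hom C Y Z\<rbrakk>
                      \<Longrightarrow> (h \<cdot> g) \<cdot> f = h \<cdot> (g \<cdot> f)"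

definition Hom_group :: "('o, 'm) cat_data \<Rightarrow> 'o \<Rightarrow> 'o \<Rightarrow> 'm monoid" where
  "Hom_group C A B = \<lparr>carrier = Hom C A B, monoid.mult = Add C, one = Zero C A B\<rparr>"

locale preadditive_category = category +
  assumes Hom_comm_group: "\<lbrakk>A \<in> Obj C; B \<in> Obj C\<rbrakk> \<Longrightarrow> comm_group (Hom_group C A B)"
    and Comp_Add: "\<lbrakk>f \<in> Hom C X Y; g \<in> Hom C X Y; h \<in> Hom C Y Z\<rbrakk>
                    \<Longrightarrow> h \<cdot> Add C f g = Add C (h \<cdot> f) (h \<cdot> g)"
    and Add_Comp: "\<lbrakk>f \<in> Hom C X Y; g \<in> Hom C Y Z; h \<in> Hom C Y Z\<rbrakk>
                    \<Longrightarrow> Add C g h \<cdot> f = Add C (g \<cdot> f) (h \<cdot> f)"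

definition zero_object :: "('o, 'm) cat_data \<Rightarrow> 'o \<Rightarrow> bool" where
  "zero_object C Z \<longleftrightarrow> Z \<in> Obj C \<and>
     (\<forall>A \<in> Obj C. (\<exists>!f. f \<in> Hom C Z A) \<and> (\<exists>!f. f \<in> Hom C A Z))"

definition biproduct ::
  "('o, 'm) cat_data \<Rightarrow> 'o \<Rightarrow> 'o \<Rightarrow> 'o \<Rightarrow> 'm \<Rightarrow> 'm \<Rightarrow> 'm \<Rightarrow> 'm \<Rightarrow> bool" where
  "biproduct C A B P p q i j \<longleftrightarrow>
     P \<in> Obj C \<and>
     p \<in> Hom C P A \<and> q \<in> Hom C P B \<and> i \<in> Hom C A P \<and> j \<in> Hom C B P \<and>
     p \<cdot>\<^bsub>C\<^esub> i = Id C A \<and> q \<cdot>\<^bsub>C\<^esub> j = Id C B \<and>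
     p \<cdot>\<^bsub>C\<^esub> j = Zero C B A \<and> q \<cdot>\<^bsub>C\<^esub> i = Zero C A B \<and>
     Add C (i \<cdot>\<^bsub>C\<^esub> p) (j \<cdot>\<^bsub>C\<^esub> q) = Id C P"

locale additive_category = preadditive_category +
  assumes ex_zero_object: "\<exists>Z. zero_object C Z"
    and ex_biproduct: "\<lbrakk>A \<in> Obj C; B \<in> Obj C\<rbrakk> \<Longrightarrow> \<exists>P p q i j. biproduct C A B P p q i j"

definition monomorphism :: "('o, 'm) cat_data \<Rightarrow> 'm \<Rightarrow> bool" where
  "monomorphism C m \<longleftrightarrow> m \<in> Arr C \<and>
     (\<forall>W. \<forall>g \<in> Hom C W (Dom C m). \<forall>h \<in> Hom C W (Dom C m). m \<cdot>\<^bsub>C\<^esub> g = m \<cdot>\<^bsub>C\<^esub> h \<longrightarrow> g = h)"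

definition cokernel_of :: "('o, 'm) cat_data \<Rightarrow> 'm \<Rightarrow> 'm \<Rightarrow> bool" where
  "cokernel_of C f p \<longleftrightarrow> f \<in> Arr C \<and> p \<in> Arr C \<and> Dom C p = Cod C f \<and>
     p \<cdot>\<^bsub>C\<^esub> f = Zero C (Dom C f) (Cod C p) \<and>
     (\<forall>T. \<forall>t \<in> Hom C (Cod C f) T. t \<cdot>\<^bsub>C\<^esub> f = Zero C (Dom C f) T \<longrightarrow>
        (\<exists>!u. u \<in> Hom C (Cod C p) T \<and> u \<cdot>\<^bsub>C\<^esub> p = t))"

definition is_cokernel :: "('o, 'm) cat_data \<Rightarrow> 'm \<Rightarrow> bool" where
  "is_cokernel C p \<longleftrightarrow> (\<exists>f. cokernel_of C f p)"

text \<open>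
  \<open>pullback C f p f' p'\<close>: the square with \<open>f \<cdot> p' = p \<cdot> f'\<close> is cartesian, so that \<open>p'\<close> is the
  pullback of \<open>p\<close> along \<open>f\<close>.
\<close>

definition pullback :: "('o, 'm) cat_data \<Rightarrow> 'm \<Rightarrow> 'm \<Rightarrow> 'm \<Rightarrow> 'm \<Rightarrow> bool" where
  "pullback C f p f' p' \<longleftrightarrow>
     f \<in> Arr C \<and> p \<in> Arr C \<and> f' \<in> Arr C \<and> p' \<in> Arr C \<and>
     Cod C f = Cod C p \<and> Dom C p' = Dom C f' \<and> Cod C p' = Dom C f \<and> Cod C f' = Dom C p \<and>
     f \<cdot>\<^bsub>C\<^esub> p' = p \<cdot>\<^bsub>C\<^esub> f' \<and>
     (\<forall>W. \<forall>a \<in> Hom C W (Dom C f). \<forall>b \<in> Hom C W (Dom C p). f \<cdot>\<^bsub>C\<^esub> a = p \<cdot>\<^bsub>C\<^esub> b \<longrightarrow>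
        (\<exists>!u. u \<in> Hom C W (Dom C p') \<and> p' \<cdot>\<^bsub>C\<^esub> u = a \<and> f' \<cdot>\<^bsub>C\<^esub> u = b))"

locale additive_regular_category = additive_category +
  assumes Reg1: "f \<in> Arr C \<Longrightarrow>
      \<exists>m p. is_cokernel C p \<and> monomorphism C m \<and> Dom C m = Cod C p \<and> f = m \<cdot> p"
    and Reg2_ex: "\<lbrakk>is_cokernel C p; f \<in> Arr C; Cod C f = Cod C p\<rbrakk>
      \<Longrightarrow> \<exists>f' p'. pullback C f p f' p'"
    and Reg2_stable: "\<lbrakk>is_cokernel C p; pullback C f p f' p'\<rbrakk> \<Longrightarrow> is_cokernel C p'"

text \<open>The full subcategory on a set of objects, with the inherited addition of arrows.\<close>

definition full_subcategory :: "('o, 'm) cat_data \<Rightarrow> 'o set \<Rightarrow> ('o, 'm) cat_data" where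
  "full_subcategory C S = C\<lparr>Obj := S, Arr := {f \<in> Arr C. Dom C f \<in> S \<and> Cod C f \<in> S}\<rparr>"

definition closed_under_subobjects :: "('o, 'm) cat_data \<Rightarrow> 'o set \<Rightarrow> bool" where
  "closed_under_subobjects C S \<longleftrightarrow> (\<forall>m. monomorphism C m \<and> Cod C m \<in> S \<longrightarrow> Dom C m \<in> S)"

end

theory Submission
  imports Defs
begin

text \<open>
  Write \<open>D\<close> for the full subcategory. Everything rests on two observations about the regular
  category \<open>E\<close>. A cokernel in \<open>E\<close> is the cokernel of its own kernel, which exists as a pullback
  along a zero arrow and is a subobject of the domain; and a pullback of \<open>A \<rightarrow> Y \<leftarrow> X\<close> is a
  subobject of \<open>A \<oplus> X\<close>, a biproduct that can be formed in the additive category \<open>D\<close> if \<open>A\<close> and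
  \<open>X\<close> lie there. So, when the given objects lie in \<open>D\<close>, closure under subobjects puts kernels,
  pullbacks, and images \<open>I\<close> of factorizations \<open>X \<rightarrow> I \<rightarrow> Y\<close> into \<open>D\<close> as well.

  The first observation makes an arrow of \<open>D\<close> that is a cokernel in \<open>E\<close> a cokernel in \<open>D\<close>
  (\<open>is_cokernel_subI\<close>), and (Reg1) passes to \<open>D\<close> at once. For (Reg2) the converse is needed too
  (\<open>is_cokernel_subD\<close>): if \<open>p = m \<cdot> q\<close> is the factorization in \<open>E\<close> of a cokernel \<open>p\<close> of \<open>D\<close>, then
  the universal property of \<open>p\<close> gives \<open>m\<close> a right inverse, so the monomorphism \<open>m\<close> is invertible
  and \<open>p\<close> is a cokernel in \<open>E\<close> along with \<open>q\<close>. Hence \<open>p\<close> has pullbacks in \<open>E\<close>, which lie in \<open>D\<close> by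
  the second observation; they are pullbacks in \<open>D\<close>, and stability follows since pullbacks in \<open>D\<close>
  are unique up to isomorphism.
\<close>

section \<open>Isomorphisms, cokernels and pullbacks\<close>

definition inverse_arrows :: "('o, 'm) cat_data \<Rightarrow> 'o \<Rightarrow> 'o \<Rightarrow> 'm \<Rightarrow> 'm \<Rightarrow> bool" where
  "inverse_arrows C X Y u v \<longleftrightarrow>
     u \<in> Hom C X Y \<and> v \<in> Hom C Y X \<and> v \<cdot>\<^bsub>C\<^esub> u = Id C X \<and> u \<cdot>\<^bsub>C\<^esub> v = Id C Y"

lemma Hom_Dom_Cod: "f \<in> Arr C \<Longrightarrow> f \<in> Hom C (Dom C f) (Cod C f)"
  by (simp add: Hom_def)

lemma HomD:
  assumes "f \<in> Hom C X Y"
  shows "f \<in> Arr C" "Dom C f = X" "Cod C f = Y"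
  using assms by (auto simp: Hom_def)

lemma monomorphism_cancel:
  "\<lbrakk>monomorphism C m; m \<in> Hom C X Y; g \<in> Hom C W X; h \<in> Hom C W X; m \<cdot>\<^bsub>C\<^esub> g = m \<cdot>\<^bsub>C\<^esub> h\<rbrakk>
    \<Longrightarrow> g = h"
  unfolding monomorphism_def by (auto dest: HomD)

lemma monomorphismI:
  assumes "m \<in> Hom C X Y"
    and "\<And>W g h. \<lbrakk>g \<in> Hom C W X; h \<in> Hom C W X; m \<cdot>\<^bsub>C\<^esub> g = m \<cdot>\<^bsub>C\<^esub> h\<rbrakk> \<Longrightarrow> g = h"
  shows "monomorphism C m"
  using assms unfolding monomorphism_def by (auto dest: HomD)

lemma cokernel_of_iff:
  assumes "f \<in> Hom C K X" "p \<in> Hom C X Y"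
  shows "cokernel_of C f p \<longleftrightarrow> p \<cdot>\<^bsub>C\<^esub> f = Zero C K Y \<and>
    (\<forall>T. \<forall>t \<in> Hom C X T. t \<cdot>\<^bsub>C\<^esub> f = Zero C K T \<longrightarrow> (\<exists>!u. u \<in> Hom C Y T \<and> u \<cdot>\<^bsub>C\<^esub> p = t))"
  using assms by (simp add: cokernel_of_def HomD)

lemma is_cokernelE:
  assumes "is_cokernel C p" "p \<in> Hom C X Y"
  obtains f K where "f \<in> Hom C K X" "cokernel_of C f p"
  using assms by (metis HomD(2) Hom_Dom_Cod cokernel_of_def is_cokernel_def)

lemma pullback_iff:
  assumes "f \<in> Hom C A Y" "p \<in> Hom C X Y" "f' \<in> Hom C P X" "p' \<in> Hom C P A"
  shows "pullback C f p f' p' \<longleftrightarrow> f \<cdot>\<^bsub>C\<^esub> p' = p \<cdot>\<^bsub>C\<^esub> f' \<and>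
    (\<forall>W. \<forall>a \<in> Hom C W A. \<forall>b \<in> Hom C W X. f \<cdot>\<^bsub>C\<^esub> a = p \<cdot>\<^bsub>C\<^esub> b \<longrightarrow>
       (\<exists>!u. u \<in> Hom C W P \<and> p' \<cdot>\<^bsub>C\<^esub> u = a \<and> f' \<cdot>\<^bsub>C\<^esub> u = b))"
  using assms by (simp add: pullback_def HomD)

lemma pullback_Hom:
  assumes "pullback C f p f' p'" "f \<in> Hom C A Y" "p \<in> Hom C X Y"
  obtains P where "f' \<in> Hom C P X" "p' \<in> Hom C P A"
  using assms by (auto simp: pullback_def Hom_def)

lemma pullback_commutes: "pullback C f p f' p' \<Longrightarrow> f \<cdot>\<^bsub>C\<^esub> p' = p \<cdot>\<^bsub>C\<^esub> f'"
  by (simp add: pullback_def)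

lemma pullback_lift:
  assumes "pullback C f p f' p'" "f' \<in> Hom C P X" "p' \<in> Hom C P A"
    and "a \<in> Hom C W A" "b \<in> Hom C W X" "f \<cdot>\<^bsub>C\<^esub> a = p \<cdot>\<^bsub>C\<^esub> b"
  obtains u where "u \<in> Hom C W P" "p' \<cdot>\<^bsub>C\<^esub> u = a" "f' \<cdot>\<^bsub>C\<^esub> u = b"
proof -
  have "\<exists>!u. u \<in> Hom C W P \<and> p' \<cdot>\<^bsub>C\<^esub> u = a \<and> f' \<cdot>\<^bsub>C\<^esub> u = b"
    using assms unfolding pullback_def by (auto simp: HomD)
  then show ?thesis using that by blast
qed

context category
begin

lemma Hom_Obj:
  assumes "f \<in> Hom C X Y"
  shows "X \<in> Obj C" "Y \<in> Obj C"
  using assms Dom_in_Obj Cod_in_Obj by (auto simp: Hom_def)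

lemma pullback_cancel:
  assumes pb: "pullback C f p f' p'" and f': "f' \<in> Hom C P X" and p': "p' \<in> Hom C P A"
    and g: "g \<in> Hom C W P" and h: "h \<in> Hom C W P"
    and eq: "p' \<cdot> g = p' \<cdot> h" "f' \<cdot> g = f' \<cdot> h"
  shows "g = h"
proof -
  obtain Y where f: "f \<in> Hom C A Y" and p: "p \<in> Hom C X Y"
    using pb f' p' by (auto simp: pullback_def Hom_def)
  have "f \<cdot> (p' \<cdot> h) = p \<cdot> (f' \<cdot> h)"
    using Comp_assoc[OF h p' f] Comp_assoc[OF h f' p] pullback_commutes[OF pb] by simp
  then have "\<exists>!u. u \<in> Hom C W P \<and> p' \<cdot> u = p' \<cdot> h \<and> f' \<cdot> u = f' \<cdot> h"
    using pb pullback_iff[OF f p f' p'] Comp_in_Hom[OF h p'] Comp_in_Hom[OF h f'] by blast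
  then show ?thesis using g h eq by blast
qed

lemma pullback_unique:
  assumes pb1: "pullback C f p f1 p1" and f1: "f1 \<in> Hom C P X" and p1: "p1 \<in> Hom C P A"
    and pb2: "pullback C f p f2 p2" and f2: "f2 \<in> Hom C Q X" and p2: "p2 \<in> Hom C Q A"
  obtains u v where "inverse_arrows C Q P u v" "p1 \<cdot> u = p2"
proof -
  obtain u where u: "u \<in> Hom C Q P" "p1 \<cdot> u = p2" "f1 \<cdot> u = f2"
    using pullback_lift[OF pb1 f1 p1 p2 f2 pullback_commutes[OF pb2]] .
  obtain v where v: "v \<in> Hom C P Q" "p2 \<cdot> v = p1" "f2 \<cdot> v = f1"
    using pullback_lift[OF pb2 f2 p2 p1 f1 pullback_commutes[OF pb1]] .
  have "v \<cdot> u = Id C Q"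
  proof (rule pullback_cancel[OF pb2 f2 p2])
    show "v \<cdot> u \<in> Hom C Q Q" "Id C Q \<in> Hom C Q Q"
      using Comp_in_Hom u v Id_in_Hom Hom_Obj by blast+
    show "p2 \<cdot> (v \<cdot> u) = p2 \<cdot> Id C Q" "f2 \<cdot> (v \<cdot> u) = f2 \<cdot> Id C Q"
      using Comp_assoc[OF u(1) v(1) p2] Comp_assoc[OF u(1) v(1) f2] u v
        Comp_Id[OF p2] Comp_Id[OF f2] by simp_all
  qed
  moreover have "u \<cdot> v = Id C P"
  proof (rule pullback_cancel[OF pb1 f1 p1])
    show "u \<cdot> v \<in> Hom C P P" "Id C P \<in> Hom C P P"
      using Comp_in_Hom u v Id_in_Hom Hom_Obj by blast+
    show "p1 \<cdot> (u \<cdot> v) = p1 \<cdot> Id C P" "f1 \<cdot> (u \<cdot> v) = f1 \<cdot> Id C P"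
      using Comp_assoc[OF v(1) u(1) p1] Comp_assoc[OF v(1) u(1) f1] u v
        Comp_Id[OF p1] Comp_Id[OF f1] by simp_all
  qed
  ultimately show ?thesis using that u v by (auto simp: inverse_arrows_def)
qed

end

section \<open>Zero arrows in a preadditive category\<close>

context preadditive_category
begin

lemma
  assumes "A \<in> Obj C" "B \<in> Obj C"
  shows Zero_in_Hom: "Zero C A B \<in> Hom C A B"
    and Add_in_Hom: "\<lbrakk>f \<in> Hom C A B; g \<in> Hom C A B\<rbrakk> \<Longrightarrow> Add C f g \<in> Hom C A B"
    and Add_Zero: "f \<in> Hom C A B \<Longrightarrow> Add C f (Zero C A B) = f"
    and Zero_Add: "f \<in> Hom C A B \<Longrightarrow> Add C (Zero C A B) f = f"
    and Add_idem: "\<lbrakk>f \<in> Hom C A B; Add C f f = f\<rbrakk> \<Longrightarrow> f = Zero C A B"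
proof -
  interpret G: comm_group "Hom_group C A B"
    using Hom_comm_group assms .
  show "Zero C A B \<in> Hom C A B"
    using G.one_closed by (simp add: Hom_group_def)
  show "f \<in> Hom C A B \<Longrightarrow> g \<in> Hom C A B \<Longrightarrow> Add C f g \<in> Hom C A B"
    using G.m_closed[of f g] by (simp add: Hom_group_def)
  show "f \<in> Hom C A B \<Longrightarrow> Add C f (Zero C A B) = f"
    using G.r_one[of f] by (simp add: Hom_group_def)
  show "f \<in> Hom C A B \<Longrightarrow> Add C (Zero C A B) f = f"
    using G.l_one[of f] by (simp add: Hom_group_def)
  show "f \<in> Hom C A B \<Longrightarrow> Add C f f = f \<Longrightarrow> f = Zero C A B"
    using G.r_cancel_one[of f f] by (simp add: Hom_group_def)
qed

lemma Comp_Zero: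
  assumes h: "h \<in> Hom C Y Z" and X: "X \<in> Obj C"
  shows "h \<cdot> Zero C X Y = Zero C X Z"
proof (rule Add_idem)
  have z: "Zero C X Y \<in> Hom C X Y" using Zero_in_Hom X Hom_Obj[OF h] by blast
  show "X \<in> Obj C" "Z \<in> Obj C" using X Hom_Obj[OF h] by auto
  show "h \<cdot> Zero C X Y \<in> Hom C X Z" using Comp_in_Hom[OF z h] .
  show "Add C (h \<cdot> Zero C X Y) (h \<cdot> Zero C X Y) = h \<cdot> Zero C X Y"
    using Comp_Add[OF z z h] Add_Zero[OF Hom_Obj[OF z] z] by simp
qed

lemma Zero_Comp:
  assumes h: "h \<in> Hom C X Y" and Z: "Z \<in> Obj C"
  shows "Zero C Y Z \<cdot> h = Zero C X Z"
proof (rule Add_idem)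
  have z: "Zero C Y Z \<in> Hom C Y Z" using Zero_in_Hom Z Hom_Obj[OF h] by blast
  show "X \<in> Obj C" "Z \<in> Obj C" using Z Hom_Obj[OF h] by auto
  show "Zero C Y Z \<cdot> h \<in> Hom C X Z" using Comp_in_Hom[OF h z] .
  show "Add C (Zero C Y Z \<cdot> h) (Zero C Y Z \<cdot> h) = Zero C Y Z \<cdot> h"
    using Add_Comp[OF h z z] Add_Zero[OF Hom_Obj[OF z] z] by simp
qed

text \<open>If \<open>p\<close> is a cokernel of \<open>g\<close>, then \<open>u \<cdot> p\<close> is also a cokernel of \<open>g\<close> for invertible \<open>u\<close>.\<close>

lemma is_cokernel_iso_Comp:
  assumes cok: "is_cokernel C p" and p: "p \<in> Hom C X Y" and iso: "inverse_arrows C Y Z u v"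
  shows "is_cokernel C (u \<cdot> p)"
proof -
  have u: "u \<in> Hom C Y Z" and v: "v \<in> Hom C Z Y" and vu: "v \<cdot> u = Id C Y" and uv: "u \<cdot> v = Id C Z"
    using iso by (auto simp: inverse_arrows_def)
  obtain g K where g: "g \<in> Hom C K X" and c: "cokernel_of C g p"
    using is_cokernelE[OF cok p] .
  note c' = c[unfolded cokernel_of_iff[OF g p]]
  have up: "u \<cdot> p \<in> Hom C X Z" using Comp_in_Hom p u .
  have "cokernel_of C g (u \<cdot> p)"
    unfolding cokernel_of_iff[OF g up]
  proof (intro conjI allI ballI impI)
    show "u \<cdot> p \<cdot> g = Zero C K Z"
      using Comp_assoc[OF g p u] c' Comp_Zero[OF u] Hom_Obj[OF g] by simp
  next
    fix T t assume t: "t \<in> Hom C X T" and tg: "t \<cdot> g = Zero C K T"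
    then have "\<exists>!w. w \<in> Hom C Y T \<and> w \<cdot> p = t" using c' by blast
    then obtain w where w: "w \<in> Hom C Y T" "w \<cdot> p = t"
      and w_uniq: "\<And>w'. w' \<in> Hom C Y T \<Longrightarrow> w' \<cdot> p = t \<Longrightarrow> w' = w"
      by blast
    show "\<exists>!x. x \<in> Hom C Z T \<and> x \<cdot> (u \<cdot> p) = t"
    proof (rule ex1I[of _ "w \<cdot> v"])
      have "w \<cdot> v \<cdot> u = w"
        using Comp_assoc[OF u v w(1)] vu Comp_Id[OF w(1)] by simp
      then show "w \<cdot> v \<in> Hom C Z T \<and> w \<cdot> v \<cdot> (u \<cdot> p) = t"
        using Comp_in_Hom[OF v w(1)] Comp_assoc[OF p u Comp_in_Hom[OF v w(1)]] w(2) by simp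
    next
      fix x assume x: "x \<in> Hom C Z T \<and> x \<cdot> (u \<cdot> p) = t"
      then have x': "x \<in> Hom C Z T" by simp
      have "x \<cdot> u = w"
        using w_uniq[OF Comp_in_Hom[OF u x']] Comp_assoc[OF p u x'] x by simp
      then show "x = w \<cdot> v"
        using Comp_assoc[OF v u x'] uv Comp_Id[OF x'] by simp
    qed
  qed
  then show ?thesis by (auto simp: is_cokernel_def)
qed

text \<open>If \<open>p\<close> is a cokernel of \<open>g\<close>, then \<open>p \<cdot> u\<close> is a cokernel of \<open>u\<^sup>-\<^sup>1 \<cdot> g\<close> for invertible \<open>u\<close>.\<close>

lemma is_cokernel_Comp_iso:
  assumes cok: "is_cokernel C p" and p: "p \<in> Hom C X Y" and iso: "inverse_arrows C W X u v"
  shows "is_cokernel C (p \<cdot> u)"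
proof -
  have u: "u \<in> Hom C W X" and v: "v \<in> Hom C X W" and vu: "v \<cdot> u = Id C W" and uv: "u \<cdot> v = Id C X"
    using iso by (auto simp: inverse_arrows_def)
  obtain g K where g: "g \<in> Hom C K X" and c: "cokernel_of C g p"
    using is_cokernelE[OF cok p] .
  note c' = c[unfolded cokernel_of_iff[OF g p]]
  have pu: "p \<cdot> u \<in> Hom C W Y" using Comp_in_Hom u p .
  have vg: "v \<cdot> g \<in> Hom C K W" using Comp_in_Hom g v .
  have uvg: "u \<cdot> (v \<cdot> g) = g" using Comp_assoc[OF g v u] uv Id_Comp[OF g] by simp
  have "cokernel_of C (v \<cdot> g) (p \<cdot> u)"
    unfolding cokernel_of_iff[OF vg pu]
  proof (intro conjI allI ballI impI)
    show "p \<cdot> u \<cdot> (v \<cdot> g) = Zero C K Y"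
      using Comp_assoc[OF vg u p] uvg c' by simp
  next
    fix T t assume t: "t \<in> Hom C W T" and tg: "t \<cdot> (v \<cdot> g) = Zero C K T"
    have tv: "t \<cdot> v \<in> Hom C X T" using Comp_in_Hom v t .
    have tvu: "t \<cdot> v \<cdot> u = t" using Comp_assoc[OF u v t] vu Comp_Id[OF t] by simp
    have "t \<cdot> v \<cdot> g = Zero C K T" using Comp_assoc[OF g v t] tg by simp
    then have "\<exists>!w. w \<in> Hom C Y T \<and> w \<cdot> p = t \<cdot> v" using c' tv by blast
    then obtain w where w: "w \<in> Hom C Y T" "w \<cdot> p = t \<cdot> v"
      and w_uniq: "\<And>w'. w' \<in> Hom C Y T \<Longrightarrow> w' \<cdot> p = t \<cdot> v \<Longrightarrow> w' = w"
      by blast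
    show "\<exists>!x. x \<in> Hom C Y T \<and> x \<cdot> (p \<cdot> u) = t"
    proof (rule ex1I[of _ w])
      show "w \<in> Hom C Y T \<and> w \<cdot> (p \<cdot> u) = t"
        using Comp_assoc[OF u p w(1)] w tvu by simp
    next
      fix x assume x: "x \<in> Hom C Y T \<and> x \<cdot> (p \<cdot> u) = t"
      then have x': "x \<in> Hom C Y T" by simp
      have xp: "x \<cdot> p \<in> Hom C X T" using Comp_in_Hom[OF p x'] .
      have "x \<cdot> p \<cdot> u = t" using x Comp_assoc[OF u p x'] by simp
      then have "x \<cdot> p = t \<cdot> v"
        using Comp_assoc[OF v u xp] uv Comp_Id[OF xp] by simp
      then show "x = w" using w_uniq x' by blast
    qed
  qed
  then show ?thesis by (auto simp: is_cokernel_def)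
qed

lemma biproduct_pairing:
  assumes bi: "biproduct C A B P p q i j" and a: "a \<in> Hom C W A" and b: "b \<in> Hom C W B"
  shows "Add C (i \<cdot> a) (j \<cdot> b) \<in> Hom C W P"
    and "p \<cdot> Add C (i \<cdot> a) (j \<cdot> b) = a"
    and "q \<cdot> Add C (i \<cdot> a) (j \<cdot> b) = b"
proof -
  have h: "p \<in> Hom C P A" "q \<in> Hom C P B" "i \<in> Hom C A P" "j \<in> Hom C B P"
    and e: "p \<cdot> i = Id C A" "q \<cdot> j = Id C B" "p \<cdot> j = Zero C B A" "q \<cdot> i = Zero C A B"
    using bi by (auto simp: biproduct_def)
  have ia: "i \<cdot> a \<in> Hom C W P" and jb: "j \<cdot> b \<in> Hom C W P"
    using Comp_in_Hom a b h by blast+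
  show "Add C (i \<cdot> a) (j \<cdot> b) \<in> Hom C W P"
    using Add_in_Hom[OF Hom_Obj[OF ia] ia jb] .
  have "p \<cdot> (i \<cdot> a) = a"
    using Comp_assoc[OF a h(3) h(1)] e Id_Comp[OF a] by simp
  moreover have "p \<cdot> (j \<cdot> b) = Zero C W A"
    using Comp_assoc[OF b h(4) h(1)] e Zero_Comp[OF b] Hom_Obj[OF a] by simp
  ultimately show "p \<cdot> Add C (i \<cdot> a) (j \<cdot> b) = a"
    using Comp_Add[OF ia jb h(1)] Add_Zero[OF Hom_Obj[OF a] a] by simp
  have "q \<cdot> (j \<cdot> b) = b"
    using Comp_assoc[OF b h(4) h(2)] e Id_Comp[OF b] by simp
  moreover have "q \<cdot> (i \<cdot> a) = Zero C W B"
    using Comp_assoc[OF a h(3) h(2)] e Zero_Comp[OF a] Hom_Obj[OF b] by simp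
  ultimately show "q \<cdot> Add C (i \<cdot> a) (j \<cdot> b) = b"
    using Comp_Add[OF ia jb h(2)] Zero_Add[OF Hom_Obj[OF b] b] by simp
qed

text \<open>
  The two legs of the pullback are jointly monic, and both are recovered from the arrow
  \<open>(p', f')\<close> into the biproduct by projecting, so this arrow is monic.
\<close>

lemma pullback_subobject_biproduct:
  assumes pb: "pullback C f p f' p'" and f': "f' \<in> Hom C P X" and p': "p' \<in> Hom C P A"
    and bi: "biproduct C A X B pA pX iA iX"
  obtains m where "m \<in> Hom C P B" "monomorphism C m"
proof -
  define m where "m = Add C (iA \<cdot> p') (iX \<cdot> f')"
  have m: "m \<in> Hom C P B" and pm: "pA \<cdot> m = p'" "pX \<cdot> m = f'"
    using biproduct_pairing[OF bi p' f'] by (auto simp: m_def)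
  have pA: "pA \<in> Hom C B A" and pX: "pX \<in> Hom C B X"
    using bi by (auto simp: biproduct_def)
  have "monomorphism C m"
  proof (rule monomorphismI[OF m])
    fix W g h assume g: "g \<in> Hom C W P" and h: "h \<in> Hom C W P" and eq: "m \<cdot> g = m \<cdot> h"
    have "p' \<cdot> g = p' \<cdot> h" "f' \<cdot> g = f' \<cdot> h"
      using Comp_assoc[OF g m pA] Comp_assoc[OF h m pA] Comp_assoc[OF g m pX] Comp_assoc[OF h m pX]
        eq pm by simp_all
    then show "g = h" using pullback_cancel[OF pb f' p' g h] by blast
  qed
  then show ?thesis using that m by blast
qed

end

section \<open>Kernels in an additive regular category\<close>

context additive_regular_category
begin

text \<open>
  The kernel \<open>k\<close> of a cokernel \<open>p\<close> is its pullback along the arrow from a zero object. Any arrow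
  \<open>g\<close> of which \<open>p\<close> is a cokernel factors through \<open>k\<close>, so an arrow killing \<open>k\<close> kills \<open>g\<close>, and
  \<open>p\<close> is a cokernel of \<open>k\<close> as well.
\<close>

lemma is_cokernel_of_mono:
  assumes cok: "is_cokernel C p" and p: "p \<in> Hom C X Y"
  obtains k K where "k \<in> Hom C K X" "monomorphism C k" "cokernel_of C k p"
proof -
  obtain Z where Z: "zero_object C Z" using ex_zero_object by blast
  then have ZO: "Z \<in> Obj C" by (simp add: zero_object_def)
  have to_Z: "a = b" if "a \<in> Hom C W Z" "b \<in> Hom C W Z" for a b W
    using Z that Hom_Obj[OF that(1)] by (auto simp: zero_object_def)
  define z where "z = Zero C Z Y"
  have z: "z \<in> Hom C Z Y"
    using Zero_in_Hom ZO Hom_Obj[OF p] by (auto simp: z_def)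
  obtain k p' where pb: "pullback C z p k p'"
    using Reg2_ex[OF cok, of z] z p by (auto simp: HomD)
  obtain K where k: "k \<in> Hom C K X" and p': "p' \<in> Hom C K Z"
    using pullback_Hom[OF pb z p] .
  have mono: "monomorphism C k"
  proof (rule monomorphismI[OF k])
    fix W g h assume g: "g \<in> Hom C W K" and h: "h \<in> Hom C W K" and eq: "k \<cdot> g = k \<cdot> h"
    show "g = h"
      using pullback_cancel[OF pb k p' g h to_Z eq] Comp_in_Hom[OF _ p'] g h by blast
  qed
  have zK: "z \<cdot> a = Zero C W Y" if "a \<in> Hom C W Z" for a W
    using Zero_Comp[OF that] Hom_Obj[OF p] by (simp add: z_def)
  obtain g G where g: "g \<in> Hom C G X" and c: "cokernel_of C g p"
    using is_cokernelE[OF cok p] .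
  note c' = c[unfolded cokernel_of_iff[OF g p]]
  have zG: "Zero C G Z \<in> Hom C G Z" using Zero_in_Hom[OF Hom_Obj(1)[OF g] ZO] .
  have "z \<cdot> Zero C G Z = p \<cdot> g" using zK[OF zG] c' by simp
  then obtain w where w: "w \<in> Hom C G K" "k \<cdot> w = g"
    using pullback_lift[OF pb k p' zG g] by blast
  have "cokernel_of C k p"
    unfolding cokernel_of_iff[OF k p]
  proof (intro conjI allI ballI impI)
    show "p \<cdot> k = Zero C K Y" using pullback_commutes[OF pb] zK[OF p'] by simp
  next
    fix T t assume t: "t \<in> Hom C X T" and tk: "t \<cdot> k = Zero C K T"
    have "t \<cdot> g = Zero C G T"
      using Comp_assoc[OF w(1) k t] w(2) tk Zero_Comp[OF w(1)] Hom_Obj[OF t] by simp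
    then show "\<exists>!u. u \<in> Hom C Y T \<and> u \<cdot> p = t" using c' t by blast
  qed
  then show ?thesis using that k mono by blast
qed

end

section \<open>Full subcategories closed under subobjects\<close>

lemma full_subcategory_simps [simp]:
  "Obj (full_subcategory C S) = S"
  "Arr (full_subcategory C S) = {f \<in> Arr C. Dom C f \<in> S \<and> Cod C f \<in> S}"
  "Dom (full_subcategory C S) = Dom C"
  "Cod (full_subcategory C S) = Cod C"
  "Id (full_subcategory C S) = Id C"
  "Comp (full_subcategory C S) = Comp C"
  "Add (full_subcategory C S) = Add C"
  "Zero (full_subcategory C S) = Zero C"
  by (simp_all add: full_subcategory_def)

lemma Hom_full_subcategory:
  "f \<in> Hom (full_subcategory C S) X Y \<longleftrightarrow> f \<in> Hom C X Y \<and> X \<in> S \<and> Y \<in> S"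
  by (auto simp: Hom_def)

lemma biproduct_full_subcategory:
  assumes "biproduct (full_subcategory C S) A B P p q i j" "S \<subseteq> Obj C"
  shows "biproduct C A B P p q i j"
  using assms by (auto simp: biproduct_def Hom_full_subcategory)

lemma monomorphism_full_subcategory:
  assumes "monomorphism C m" "m \<in> Hom C X Y" "X \<in> S" "Y \<in> S"
  shows "monomorphism (full_subcategory C S) m"
proof (rule monomorphismI)
  show "m \<in> Hom (full_subcategory C S) X Y" using assms by (simp add: Hom_full_subcategory)
qed (use monomorphism_cancel[OF assms(1,2)] in \<open>auto simp: Hom_full_subcategory\<close>)

lemma cokernel_of_full_subcategory:
  assumes c: "cokernel_of C f p" and f: "f \<in> Hom C K X" and p: "p \<in> Hom C X Y"
    and S: "K \<in> S" "X \<in> S" "Y \<in> S"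
  shows "cokernel_of (full_subcategory C S) f p"
proof -
  have f': "f \<in> Hom (full_subcategory C S) K X" and p': "p \<in> Hom (full_subcategory C S) X Y"
    using f p S by (simp_all add: Hom_full_subcategory)
  show ?thesis
    using c S unfolding cokernel_of_iff[OF f' p'] cokernel_of_iff[OF f p]
    by (simp add: Hom_full_subcategory)
qed

lemma pullback_full_subcategory:
  assumes pb: "pullback C f p f' p'"
    and f: "f \<in> Hom C A Y" and p: "p \<in> Hom C X Y" and f': "f' \<in> Hom C P X" and p': "p' \<in> Hom C P A"
    and S: "A \<in> S" "X \<in> S" "Y \<in> S" "P \<in> S"
  shows "pullback (full_subcategory C S) f p f' p'"
proof -
  let ?D = "full_subcategory C S"
  have h: "f \<in> Hom ?D A Y" "p \<in> Hom ?D X Y" "f' \<in> Hom ?D P X" "p' \<in> Hom ?D P A"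
    using f p f' p' S by (simp_all add: Hom_full_subcategory)
  show ?thesis
    using pb S unfolding pullback_iff[OF h] pullback_iff[OF f p f' p']
    by (simp add: Hom_full_subcategory)
qed

locale subobject_closed_subcategory = additive_regular_category E
  for E :: "('o, 'm) cat_data" (structure) +
  fixes S :: "'o set"
  assumes S_sub: "S \<subseteq> Obj E"
    and sub_additive: "additive_category (full_subcategory E S)"
    and S_closed: "closed_under_subobjects E S"
begin

abbreviation "D \<equiv> full_subcategory E S"

sublocale D: additive_category D
  by (rule sub_additive)

lemma mono_Dom_in_S: "\<lbrakk>monomorphism E m; m \<in> Hom E X Y; Y \<in> S\<rbrakk> \<Longrightarrow> X \<in> S"
  using S_closed by (auto simp: closed_under_subobjects_def HomD)

text \<open>
  An arrow of which \<open>p\<close> is a cokernel may start outside \<open>S\<close>; the kernel of \<open>p\<close> does not.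
\<close>

lemma is_cokernel_subI:
  assumes "is_cokernel E p" and p: "p \<in> Hom E X Y" and S: "X \<in> S" "Y \<in> S"
  shows "is_cokernel D p"
proof -
  obtain k K where k: "k \<in> Hom E K X" "monomorphism E k" and c: "cokernel_of E k p"
    using is_cokernel_of_mono[OF assms(1,2)] .
  have "K \<in> S" using mono_Dom_in_S k S by blast
  then have "cokernel_of D k p"
    using cokernel_of_full_subcategory[OF c k(1) p] S by blast
  then show ?thesis by (auto simp: is_cokernel_def)
qed

text \<open>
  The universal property of \<open>p\<close> in \<open>D\<close> says nothing about targets outside \<open>S\<close>, but it applies to
  the image of \<open>p\<close> in \<open>E\<close>, and forces this image to be the whole codomain.
\<close>

lemma is_cokernel_subD:
  assumes cok: "is_cokernel D p"
  shows "is_cokernel E p"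
proof -
  have "p \<in> Arr D" using cok by (auto simp: is_cokernel_def cokernel_of_def)
  then obtain X Y where p: "p \<in> Hom E X Y" and S: "X \<in> S" "Y \<in> S"
    using Hom_Dom_Cod[of p E] by auto
  then have pD: "p \<in> Hom D X Y" by (simp add: Hom_full_subcategory)
  obtain g K where gD: "g \<in> Hom D K X" and c: "cokernel_of D g p"
    using is_cokernelE[OF cok pD] .
  have g: "g \<in> Hom E K X" and KS: "K \<in> S" using gD by (simp_all add: Hom_full_subcategory)
  have pg: "p \<cdot> g = Zero E K Y"
    and univ: "\<And>T t. \<lbrakk>T \<in> S; t \<in> Hom E X T; t \<cdot> g = Zero E K T\<rbrakk>
        \<Longrightarrow> \<exists>!u. u \<in> Hom E Y T \<and> u \<cdot> p = t"
    using c S unfolding cokernel_of_iff[OF gD pD] by (simp_all add: Hom_full_subcategory)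
  obtain m q where cq: "is_cokernel E q" and mm: "monomorphism E m"
    and mq: "Dom E m = Cod E q" "p = m \<cdot> q"
    using Reg1 HomD(1)[OF p] by metis
  have "q \<in> Arr E" "m \<in> Arr E"
    using cq mm by (auto simp: is_cokernel_def cokernel_of_def monomorphism_def)
  then obtain X' I Y' where qm: "q \<in> Hom E X' I" "m \<in> Hom E I Y'"
    using mq(1) Hom_Dom_Cod[of q E] Hom_Dom_Cod[of m E] by simp
  then have "X' = X" "Y' = Y" using Comp_in_Hom[OF qm] mq(2) p by (auto simp: Hom_def)
  then have q: "q \<in> Hom E X I" and m: "m \<in> Hom E I Y" using qm by auto
  have IS: "I \<in> S" using mono_Dom_in_S mm m S by blast
  have KO: "K \<in> Obj E" and IO: "I \<in> Obj E" and YO: "Y \<in> Obj E"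
    using Hom_Obj g m by blast+
  have "q \<cdot> g = Zero E K I"
  proof (rule monomorphism_cancel[OF mm m])
    show "m \<cdot> (q \<cdot> g) = m \<cdot> Zero E K I"
      using Comp_assoc[OF g q m] mq(2) pg Comp_Zero[OF m KO] by simp
  qed (use Comp_in_Hom[OF g q] Zero_in_Hom[OF KO IO] in auto)
  then obtain u where u: "u \<in> Hom E Y I" "u \<cdot> p = q" using univ IS q by blast
  have mu: "m \<cdot> u \<in> Hom E Y Y" using Comp_in_Hom u m by blast
  have "m \<cdot> u \<cdot> p = p" using Comp_assoc[OF p u(1) m] u(2) mq(2) by simp
  \<comment> \<open>The uniqueness in the universal property, applied to \<open>p\<close> itself, cancels \<open>p\<close>.\<close>
  then have mu_id: "m \<cdot> u = Id E Y"
    using univ[OF S(2) p pg] mu Id_in_Hom[OF YO] Id_Comp[OF p] by blast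
  have "u \<cdot> m = Id E I"
  proof (rule monomorphism_cancel[OF mm m])
    show "m \<cdot> (u \<cdot> m) = m \<cdot> Id E I"
      using Comp_assoc[OF m u(1) m] mu_id Id_Comp[OF m] Comp_Id[OF m] by simp
  qed (use Comp_in_Hom[OF m u(1)] Id_in_Hom[OF IO] in auto)
  then have "inverse_arrows E I Y m u" using mu_id m u by (simp add: inverse_arrows_def)
  then show ?thesis using is_cokernel_iso_Comp[OF cq q] mq(2) by simp
qed

lemma pullback_vertex_in_S:
  assumes pb: "pullback E f p f' p'" and f': "f' \<in> Hom E P X" and p': "p' \<in> Hom E P A"
    and S: "A \<in> S" "X \<in> S"
  shows "P \<in> S"
proof -
  obtain B pA pX iA iX where biD: "biproduct D A X B pA pX iA iX"
    using D.ex_biproduct[of A X] S by auto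
  then have "B \<in> S" by (simp add: biproduct_def)
  moreover obtain m where "m \<in> Hom E P B" "monomorphism E m"
    using pullback_subobject_biproduct[OF pb f' p' biproduct_full_subcategory[OF biD S_sub]] .
  ultimately show ?thesis using mono_Dom_in_S by blast
qed

text \<open>
  A pullback in \<open>D\<close> is not a priori one in \<open>E\<close>, where there are more test objects. One that is a
  pullback in both categories provides the comparison needed for stability.
\<close>

lemma ex_common_pullback:
  assumes cok: "is_cokernel D p" and p: "p \<in> Hom E X Y" and f: "f \<in> Hom E A Y"
    and S: "A \<in> S" "X \<in> S" "Y \<in> S"
  obtains P f' p' where "P \<in> S" "f' \<in> Hom E P X" "p' \<in> Hom E P A"
    "pullback E f p f' p'" "pullback D f p f' p'"
proof -
  obtain f' p' where pb: "pullback E f p f' p'"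
    using Reg2_ex[OF is_cokernel_subD[OF cok], of f] p f by (auto simp: HomD)
  obtain P where P: "f' \<in> Hom E P X" "p' \<in> Hom E P A"
    using pullback_Hom[OF pb f p] .
  have "P \<in> S" using pullback_vertex_in_S[OF pb P] S by blast
  then show ?thesis using that P pb pullback_full_subcategory[OF pb f p P] S by blast
qed

lemma sub_Reg1:
  assumes f: "f \<in> Arr D"
  shows "\<exists>m p. is_cokernel D p \<and> monomorphism D m \<and> Dom E m = Cod E p \<and> f = m \<cdot> p"
proof -
  obtain m p where cp: "is_cokernel E p" and mm: "monomorphism E m"
    and mp: "Dom E m = Cod E p" "f = m \<cdot> p"
    using Reg1 f by fastforce
  have "p \<in> Arr E" "m \<in> Arr E"
    using cp mm by (auto simp: is_cokernel_def cokernel_of_def monomorphism_def)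
  then obtain X I Y where p: "p \<in> Hom E X I" and m: "m \<in> Hom E I Y"
    using mp(1) Hom_Dom_Cod[of p E] Hom_Dom_Cod[of m E] by simp
  have XY: "X \<in> S" "Y \<in> S" using Comp_in_Hom[OF p m] mp(2) f by (auto simp: HomD)
  then have "I \<in> S" using mono_Dom_in_S mm m by blast
  then show ?thesis
    using is_cokernel_subI[OF cp p] monomorphism_full_subcategory[OF mm m] XY mp by blast
qed

lemma sub_Reg2_ex:
  assumes cok: "is_cokernel D p" and f: "f \<in> Arr D" and Cod: "Cod E f = Cod E p"
  shows "\<exists>f' p'. pullback D f p f' p'"
proof -
  have "p \<in> Arr D" using cok by (auto simp: is_cokernel_def cokernel_of_def)
  then have p: "p \<in> Hom E (Dom E p) (Cod E p)" and S: "Dom E p \<in> S" "Cod E p \<in> S"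
    by (auto intro: Hom_Dom_Cod)
  have "f \<in> Hom E (Dom E f) (Cod E p)" "Dom E f \<in> S"
    using f Cod by (auto simp: Hom_def)
  then show ?thesis using ex_common_pullback[OF cok p] S by metis
qed

lemma sub_Reg2_stable:
  assumes cok: "is_cokernel D p" and pb: "pullback D f p f' p'"
  shows "is_cokernel D p'"
proof -
  have "f \<in> Hom D (Dom E f) (Cod E f)" "p \<in> Hom D (Dom E p) (Cod E f)"
    "f' \<in> Hom D (Dom E f') (Dom E p)" "p' \<in> Hom D (Dom E f') (Dom E f)"
    using pb by (simp_all add: pullback_def Hom_def)
  then obtain A X Y Q
    where h: "f \<in> Hom D A Y" "p \<in> Hom D X Y" "f' \<in> Hom D Q X" "p' \<in> Hom D Q A"
    by blast
  then have f: "f \<in> Hom E A Y" and p: "p \<in> Hom E X Y" and p': "p' \<in> Hom E Q A"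
    and S: "A \<in> S" "X \<in> S" "Y \<in> S" "Q \<in> S"
    by (simp_all add: Hom_full_subcategory)
  obtain P f1 p1 where PS: "P \<in> S" and f1: "f1 \<in> Hom E P X" and p1: "p1 \<in> Hom E P A"
    and pbE: "pullback E f p f1 p1" and pbD: "pullback D f p f1 p1"
    using ex_common_pullback[OF cok p f S(1-3)] .
  have D1: "f1 \<in> Hom D P X" "p1 \<in> Hom D P A"
    using f1 p1 PS S by (simp_all add: Hom_full_subcategory)
  obtain u v where "inverse_arrows D Q P u v" and p1u: "p1 \<cdot> u = p'"
    using D.pullback_unique[OF pbD D1 pb h(3,4)] by auto
  then have iso: "inverse_arrows E Q P u v"
    by (simp add: inverse_arrows_def Hom_full_subcategory)
  have "is_cokernel E p1" using Reg2_stable[OF is_cokernel_subD[OF cok] pbE] .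
  then have "is_cokernel E p'" using is_cokernel_Comp_iso[OF _ p1 iso] p1u by simp
  then show ?thesis using is_cokernel_subI[OF _ p'] S by blast
qed

end

theorem proposition1p2:
  fixes E :: "('o, 'm) cat_data" and S :: "'o set"
  assumes "additive_regular_category E"
    and "S \<subseteq> Obj E"
    and "additive_category (full_subcategory E S)"
    and "closed_under_subobjects E S"
  shows "additive_regular_category (full_subcategory E S)"
proof -
  interpret subobject_closed_subcategory E S
    using assms by (simp add: subobject_closed_subcategory_def subobject_closed_subcategory_axioms_def)
  show ?thesis
    using sub_Reg1 sub_Reg2_ex sub_Reg2_stable
    by unfold_locales (simp_all del: full_subcategory_simps(2))
qed

end
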